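(* Let $k\ge 2$ and let $r,s$ be integers with $1\le r\le s$. Then $D_{r,2,s}$ is a $\mathsf{TS}_k$-graph if and only if $s\le k-1$.
   Context: Graphs are finite, simple and undirected. For a graph $G$ and an integer $k\ge 2$, $\mathsf{TS}_k(G)$ is the graph whose nodes are all size-$k$ independent sets of $G$, two nodes $I,J$ being adjacent if there are vertices $u,v$ of $G$ with $I\setminus J=\{u\}$, $J\setminus I=\{v\}$ and $uv\in E(G)$. A graph is a $\mathsf{TS}_k$-graph if it is isomorphic to $\mathsf{TS}_k(G)$ for some graph $G$. $D_{r,2,s}$ is the tree obtained from a single edge $p_1p_2$ by attaching $r$ leaves to $p_1$ and $s$ leaves to $p_2$. *)

theory Defs
  imports "Graph_Theory.Graph_Theory"
begin

text \<open>
  A finite simple undirected graph is a \<^locale>\<open>pair_graph\<close>: a finite loopless digraph without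
  parallel arcs whose arc relation is symmetric, an edge \<open>uv\<close> being the two arcs
  \<open>(u,v)\<close> and \<open>(v,u)\<close>.
\<close>

definition independent_set :: "'a pair_pre_digraph \<Rightarrow> 'a set \<Rightarrow> bool" where
  "independent_set G I \<longleftrightarrow> I \<subseteq> pverts G \<and> (\<forall>u\<in>I. \<forall>v\<in>I. (u, v) \<notin> parcs G)"

definition TS_nodes :: "nat \<Rightarrow> 'a pair_pre_digraph \<Rightarrow> 'a set set" where
  "TS_nodes k G = {I. independent_set G I \<and> card I = k}"

definition TS :: "nat \<Rightarrow> 'a pair_pre_digraph \<Rightarrow> 'a set pair_pre_digraph" where
  "TS k G = \<lparr> pverts = TS_nodes k G,
     parcs = {(I, J). I \<in> TS_nodes k G \<and> J \<in> TS_nodes k G \<and>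
               (\<exists>u v. I - J = {u} \<and> J - I = {v} \<and> (u, v) \<in> parcs G)} \<rparr>"

text \<open>
  HOL cannot quantify over all vertex types inside a formula, so the vertices of \<open>G\<close> are natural
  numbers; the lemma \<open>is_TS_graphI\<close> below shows that this excludes no finite graph.
\<close>

definition is_TS_graph :: "nat \<Rightarrow> 'b pair_pre_digraph \<Rightarrow> bool" where
  "is_TS_graph k H \<longleftrightarrow>
     (\<exists>G :: nat pair_pre_digraph. pair_graph G \<and> digraph_iso (with_proj H) (with_proj (TS k G)))"

datatype D_vertex = P1 | P2 | Leaf1 nat | Leaf2 nat

definition D_edges :: "nat \<Rightarrow> nat \<Rightarrow> D_vertex rel" where
  "D_edges r s = {(P1, P2)} \<union> {(P1, Leaf1 i) | i. i < r} \<union> {(P2, Leaf2 j) | j. j < s}"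

definition D_graph :: "nat \<Rightarrow> nat \<Rightarrow> D_vertex pair_pre_digraph" where
  "D_graph r s = \<lparr> pverts = {P1, P2} \<union> Leaf1 ` {..<r} \<union> Leaf2 ` {..<s},
     parcs = D_edges r s \<union> (D_edges r s)\<inverse> \<rparr>"

lemma pair_graph_D_graph: "pair_graph (D_graph r s)"
proof -
  have "finite (D_edges r s)" by (auto simp: D_edges_def)
  then show ?thesis
    by unfold_locales (auto simp: D_graph_def D_edges_def symmetric_def intro!: symI)
qed

lemma pair_graph_TS:
  assumes "pair_graph G"
  shows "pair_graph (TS k G)"
proof -
  interpret pair_graph G by fact
  have fin: "finite (TS_nodes k G)"
    by (rule finite_subset[of _ "Pow (pverts G)"]) (auto simp: TS_nodes_def independent_set_def)
  have "finite (parcs (TS k G))"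
    by (rule finite_subset[of _ "TS_nodes k G \<times> TS_nodes k G"]) (use fin in \<open>auto simp: TS_def\<close>)
  moreover have "symmetric (with_proj (TS k G))"
    unfolding symmetric_def with_proj_simps
  proof (rule symI)
    fix I J assume "(I, J) \<in> parcs (TS k G)"
    then obtain u v where "I \<in> TS_nodes k G" "J \<in> TS_nodes k G"
      "I - J = {u}" "J - I = {v}" "(u, v) \<in> parcs G" by (auto simp: TS_def)
    then show "(J, I) \<in> parcs (TS k G)" using arcs_symmetric[of u v] by (simp add: TS_def)
  qed
  moreover have "fst e \<in> pverts (TS k G) \<and> snd e \<in> pverts (TS k G) \<and> fst e \<noteq> snd e"
    if "e \<in> parcs (TS k G)" for e
  proof -
    obtain I J where e: "e = (I, J)" by (cases e)
    with that obtain u where "I \<in> TS_nodes k G" "J \<in> TS_nodes k G" and u: "I - J = {u}"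
      by (simp add: TS_def) blast
    moreover have "I \<noteq> J"
    proof
      assume "I = J"
      with u have "{} = {u}" by (simp only: Diff_cancel)
      then show False by simp
    qed
    ultimately show ?thesis by (simp add: TS_def e)
  qed
  moreover have "finite (pverts (TS k G))" using fin by (simp add: TS_def)
  ultimately show ?thesis by unfold_locales blast+
qed

lemma digraph_iso_with_proj_iff:
  assumes "pair_wf_digraph H"
  shows "digraph_iso (with_proj H) (with_proj K) \<longleftrightarrow>
    (\<exists>f. inj_on f (pverts H) \<and> pverts K = f ` pverts H \<and> parcs K = map_prod f f ` parcs H)"
proof
  assume "digraph_iso (with_proj H) (with_proj K)"
  then obtain h where h: "pre_digraph.digraph_isomorphism (with_proj H) h"
    and K: "with_proj K = app_iso h (with_proj H)" by (auto simp: digraph_iso_def)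
  let ?f = "iso_verts h"
  have t: "iso_tail h = fst" "iso_head h = snd" "pverts K = ?f ` pverts H" "parcs K = iso_arcs h ` parcs H"
    using K by (auto simp: with_proj_def app_iso_def)
  have "iso_arcs h a = map_prod ?f ?f a" if "a \<in> parcs H" for a
    using h that t(1,2) by (cases a, cases "iso_arcs h a") (auto simp: pre_digraph.digraph_isomorphism_def)
  then have "parcs K = map_prod ?f ?f ` parcs H" using t(4) by auto
  with h t(3) show "\<exists>f. inj_on f (pverts H) \<and> pverts K = f ` pverts H \<and> parcs K = map_prod f f ` parcs H"
    by (auto simp: pre_digraph.digraph_isomorphism_def)
next
  assume "\<exists>f. inj_on f (pverts H) \<and> pverts K = f ` pverts H \<and> parcs K = map_prod f f ` parcs H"
  then obtain f where f: "inj_on f (pverts H)" "pverts K = f ` pverts H" "parcs K = map_prod f f ` parcs H"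
    by blast
  let ?h = "\<lparr>iso_verts = f, iso_arcs = map_prod f f, iso_head = snd, iso_tail = fst\<rparr>"
  interpret pair_wf_digraph H by fact
  have "inj_on (map_prod f f) (parcs H)"
    by (rule inj_on_subset[OF map_prod_inj_on[OF f(1) f(1)]]) (auto dest: in_arcsD1 in_arcsD2)
  then have "pre_digraph.digraph_isomorphism (with_proj H) ?h"
    using f(1) assms by (auto simp: pre_digraph.digraph_isomorphism_def wf_digraph_wp_iff)
  moreover have "with_proj K = app_iso ?h (with_proj H)"
    using f by (auto simp: with_proj_def app_iso_def)
  ultimately show "digraph_iso (with_proj H) (with_proj K)" by (auto simp: digraph_iso_def)
qed

lemma is_TS_graphI:
  fixes G :: "'a pair_pre_digraph"
  assumes G: "pair_graph G" and H: "pair_wf_digraph H"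
    and iso: "digraph_iso (with_proj H) (with_proj (TS k G))"
  shows "is_TS_graph k H"
proof -
  interpret G: pair_graph G by fact
  obtain g :: "'a \<Rightarrow> nat" where g: "inj_on g (pverts G)"
    using finite_imp_inj_to_nat_seg[OF G.pair_finite_verts] by metis
  let ?G' = "\<lparr>pverts = g ` pverts G, parcs = map_prod g g ` parcs G\<rparr>"
  have g_eq: "g x = g y \<longleftrightarrow> x = y" if "x \<in> pverts G" "y \<in> pverts G" for x y
    using g that by (auto dest: inj_onD)
  have G': "pair_graph ?G'"
  proof unfold_locales
    fix e assume "e \<in> parcs ?G'"
    then obtain x y where "e = (g x, g y)" "(x, y) \<in> parcs G" by auto
    then show "fst e \<noteq> snd e" using g_eq G.in_arcsD1 G.in_arcsD2 G.no_loops' by auto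
  next
    show "symmetric (with_proj ?G')"
      using G.arcs_symmetric by (force simp: symmetric_def intro!: symI)
  qed (use G.pair_finite_verts G.pair_finite_arcs G.in_arcsD1 G.in_arcsD2 in force)+
  have arc_iff: "(g x, g y) \<in> parcs ?G' \<longleftrightarrow> (x, y) \<in> parcs G"
    if "x \<in> pverts G" "y \<in> pverts G" for x y
    using that g_eq G.in_arcsD1 G.in_arcsD2 by (force simp: image_iff)
  have node_sub: "I \<subseteq> pverts G" if "I \<in> TS_nodes k G" for I
    using that by (auto simp: TS_nodes_def independent_set_def)
  have img_node: "g ` I \<in> TS_nodes k ?G' \<longleftrightarrow> I \<in> TS_nodes k G" if I: "I \<subseteq> pverts G" for I
  proof -
    have "card (g ` I) = card I" by (rule card_image) (rule inj_on_subset[OF g I])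
    moreover have "(\<forall>u\<in>g ` I. \<forall>v\<in>g ` I. (u, v) \<notin> parcs ?G') \<longleftrightarrow> (\<forall>u\<in>I. \<forall>v\<in>I. (u, v) \<notin> parcs G)"
      using arc_iff I by (simp add: subset_iff del: pair_pre_digraph.simps)
    moreover have "g ` I \<subseteq> pverts ?G'" using I by auto
    ultimately show ?thesis using I
      by (simp add: TS_nodes_def independent_set_def del: pair_pre_digraph.simps)
  qed
  have nodes: "TS_nodes k ?G' = (`) g ` TS_nodes k G"
  proof
    show "TS_nodes k ?G' \<subseteq> (`) g ` TS_nodes k G"
    proof
      fix J assume J: "J \<in> TS_nodes k ?G'"
      then have "J \<subseteq> g ` pverts G" by (auto simp: TS_nodes_def independent_set_def)
      then obtain I where "I \<subseteq> pverts G" "J = g ` I" by (auto simp: subset_image_iff)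
      then show "J \<in> (`) g ` TS_nodes k G" using J img_node by blast
    qed
  qed (use img_node node_sub in blast)
  have slide: "(g ` I, g ` J) \<in> parcs (TS k ?G') \<longleftrightarrow> (I, J) \<in> parcs (TS k G)"
    if I: "I \<in> TS_nodes k G" and J: "J \<in> TS_nodes k G" for I J
  proof -
    have sub: "I \<subseteq> pverts G" "J \<subseteq> pverts G" using I J node_sub by auto
    have diff: "g ` I - g ` J = g ` (I - J)" "g ` J - g ` I = g ` (J - I)"
      using inj_on_image_set_diff[OF g] sub by (metis Diff_subset order.trans)+
    have sing: "g ` A = {a} \<longleftrightarrow> (\<exists>x. A = {x} \<and> a = g x)" if "A \<subseteq> pverts G" for A a
    proof
      assume *: "g ` A = {a}"
      then obtain x where x: "x \<in> A" "g x = a" by blast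
      have "y = x" if "y \<in> A" for y
        using * x that \<open>A \<subseteq> pverts G\<close> g_eq[of y x] by blast
      then show "\<exists>x. A = {x} \<and> a = g x" using x by blast
    qed auto
    have s1: "I - J \<subseteq> pverts G" "J - I \<subseteq> pverts G" using sub by auto
    have "(\<exists>u v. g ` I - g ` J = {u} \<and> g ` J - g ` I = {v} \<and> (u, v) \<in> parcs ?G') \<longleftrightarrow>
        (\<exists>x y. I - J = {x} \<and> J - I = {y} \<and> (g x, g y) \<in> parcs ?G')"
      unfolding diff sing[OF s1(1)] sing[OF s1(2)] by blast
    also have "\<dots> \<longleftrightarrow> (\<exists>x y. I - J = {x} \<and> J - I = {y} \<and> (x, y) \<in> parcs G)"
      using arc_iff s1 by (metis insert_subset)
    finally show ?thesis using I J img_node sub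
      by (simp add: TS_def del: image_iff)
  qed
  have inj: "inj_on ((`) g) (TS_nodes k G)"
    using node_sub inj_on_image_eq_iff[OF g] by (auto intro!: inj_onI)
  have arcs: "parcs (TS k ?G') = map_prod ((`) g) ((`) g) ` parcs (TS k G)"
  proof
    show "parcs (TS k ?G') \<subseteq> map_prod ((`) g) ((`) g) ` parcs (TS k G)"
    proof
      fix e assume e: "e \<in> parcs (TS k ?G')"
      then obtain I' J' where "e = (I', J')" "I' \<in> TS_nodes k ?G'" "J' \<in> TS_nodes k ?G'"
        by (auto simp: TS_def)
      then obtain I J where "e = (g ` I, g ` J)" "I \<in> TS_nodes k G" "J \<in> TS_nodes k G"
        unfolding nodes by blast
      then show "e \<in> map_prod ((`) g) ((`) g) ` parcs (TS k G)" using e slide by force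
    qed
    show "map_prod ((`) g) ((`) g) ` parcs (TS k G) \<subseteq> parcs (TS k ?G')"
    proof
      fix e assume "e \<in> map_prod ((`) g) ((`) g) ` parcs (TS k G)"
      then obtain I J where "e = (g ` I, g ` J)" "(I, J) \<in> parcs (TS k G)" by auto
      moreover from this have "I \<in> TS_nodes k G" "J \<in> TS_nodes k G" by (auto simp: TS_def)
      ultimately show "e \<in> parcs (TS k ?G')" using slide by blast
    qed
  qed
  obtain f where f: "inj_on f (pverts H)" "pverts (TS k G) = f ` pverts H"
      "parcs (TS k G) = map_prod f f ` parcs H"
    using iso unfolding digraph_iso_with_proj_iff[OF H] by (elim exE conjE)
  have "inj_on ((`) g) (f ` pverts H)" using inj f(2) by (simp add: TS_def)
  with f(1) have "inj_on ((`) g \<circ> f) (pverts H)" by (rule comp_inj_on)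
  moreover have "pverts (TS k ?G') = ((`) g \<circ> f) ` pverts H"
    using f(2) nodes by (simp add: TS_def image_comp)
  moreover have "parcs (TS k ?G') = map_prod ((`) g \<circ> f) ((`) g \<circ> f) ` parcs H"
    unfolding arcs f(3) by (simp add: image_comp map_prod.comp)
  ultimately have "digraph_iso (with_proj H) (with_proj (TS k ?G'))"
    unfolding digraph_iso_with_proj_iff[OF H] by (intro exI conjI)
  with G' show ?thesis unfolding is_TS_graph_def by (intro exI conjI)
qed

end

theory Submission
  imports Defs
begin

text \<open>
  Necessity: let \<open>I\<close> be the node of \<open>TS k G\<close> corresponding to \<open>p\<^sub>2\<close>. Suppose that two neighbours
  \<open>I - u + v\<close> and \<open>I - u + w\<close> of \<open>I\<close> move the same token \<open>u\<close>. As there is no triangle, \<open>v\<close> and \<open>w\<close>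
  are not adjacent, so \<open>S = I - u + v + w\<close> is independent. For a further token \<open>x\<close> of \<open>I\<close>, the set
  \<open>S - x\<close> would have to be at distance at most two from \<open>I\<close>; but a middle node must be
  \<open>I - u + v\<close> or \<open>I - u + w\<close>, from where \<open>x\<close> would have to slide to the non-adjacent \<open>w\<close> or \<open>v\<close>.
  Hence the \<open>s + 1\<close> neighbours of \<open>I\<close> move distinct tokens, and \<open>s + 1 \<le> k\<close>.

  Sufficiency: give each of the tokens \<open>u\<^sub>0, \<dots>, u\<^sub>s\<close> of \<open>I = {u\<^sub>0, \<dots>, u\<^sub>k\<^sub>-\<^sub>1}\<close> its own target \<open>v\<^sub>i\<close>,
  the targets forming a clique. After the move \<open>u\<^sub>0 \<rightarrow> v\<^sub>0\<close> a second clique of targets \<open>w\<^sub>j\<close> becomes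
  available, which before was blocked by \<open>u\<^sub>0\<close>.
\<close>

section \<open>Necessity: the number of neighbours of a central node\<close>

lemma TS_nodesD:
  assumes "I \<in> TS_nodes k G"
  shows "I \<subseteq> pverts G" "card I = k" "\<And>u v. u \<in> I \<Longrightarrow> v \<in> I \<Longrightarrow> (u, v) \<notin> parcs G"
  using assms by (auto simp: TS_nodes_def independent_set_def)

lemma TS_arc_iff:
  "(I, J) \<in> parcs (TS k G) \<longleftrightarrow> I \<in> TS_nodes k G \<and> J \<in> TS_nodes k G \<and>
     (\<exists>u v. I - J = {u} \<and> J - I = {v} \<and> (u, v) \<in> parcs G)"
  by (simp add: TS_def)

text \<open>\<open>I\<close> stands for the image of \<open>P2\<close>: \<open>triangle_free\<close>
  and \<open>radius\<close> record that it lies on no triangle and has every node within distance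
  two. The singleton \<open>I - J\<close> encodes the moved token.\<close>

lemma TS_moved_token_inj:
  assumes G: "pair_graph G" and k: "k \<ge> 2"
    and triangle_free: "\<And>J K. (I, J) \<in> parcs (TS k G) \<Longrightarrow> (I, K) \<in> parcs (TS k G) \<Longrightarrow>
      (J, K) \<notin> parcs (TS k G)"
    and radius: "\<And>N. N \<in> TS_nodes k G \<Longrightarrow> N \<noteq> I \<Longrightarrow> (I, N) \<notin> parcs (TS k G) \<Longrightarrow>
      \<exists>Q. (I, Q) \<in> parcs (TS k G) \<and> (Q, N) \<in> parcs (TS k G)"
    and J: "(I, J) \<in> parcs (TS k G)" and K: "(I, K) \<in> parcs (TS k G)"
    and same: "I - J = I - K"
  shows "J = K"
proof (rule ccontr)
  assume "J \<noteq> K"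
  interpret pair_graph G by fact
  note sym = arcs_symmetric
  obtain u v where uv: "I - J = {u}" "J - I = {v}" "(u, v) \<in> parcs G"
    using J by (auto simp: TS_arc_iff)
  obtain w where uw: "I - K = {u}" "K - I = {w}" "(u, w) \<in> parcs G"
    using K same uv(1) by (auto simp: TS_arc_iff)
  have I: "I \<in> TS_nodes k G" and J': "J \<in> TS_nodes k G" and K': "K \<in> TS_nodes k G"
    using J K by (auto simp: TS_arc_iff)
  have fin: "finite I" using k TS_nodesD(2)[OF I] by (intro card_ge_0_finite) simp
  have J_eq: "J = insert v (I - {u})" and K_eq: "K = insert w (I - {u})" using uv uw by blast+
  have "v \<noteq> w" using \<open>J \<noteq> K\<close> J_eq K_eq by blast
  have uvw: "u \<in> I" "v \<notin> I" "w \<notin> I" using uv uw by blast+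
  \<comment> \<open>Otherwise sliding \<open>v\<close> to \<open>w\<close> leads from
    \<open>J\<close> to \<open>K\<close>, closing a triangle with \<open>I\<close>.\<close>
  have "(v, w) \<notin> parcs G"
  proof
    assume "(v, w) \<in> parcs G"
    moreover have "J - K = {v}" "K - J = {w}" using J_eq K_eq \<open>v \<noteq> w\<close> uvw by blast+
    ultimately have "(J, K) \<in> parcs (TS k G)" using J' K' by (simp add: TS_arc_iff)
    with triangle_free J K show False by blast
  qed
  have "card (I - {u}) = k - 1" using uvw fin TS_nodesD(2)[OF I] by simp
  with k have "I - {u} \<noteq> {}" by (intro notI) simp
  then obtain x where x: "x \<in> I" "x \<noteq> u" by blast
  \<comment> \<open>\<open>N\<close> is the set \<open>S - x\<close> of the outline; the second
    token \<open>x\<close> exists because \<open>k \<ge> 2\<close>.\<close>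
  define N where "N = insert v (insert w (I - {u, x}))"
  have "card (I - {u, x}) = k - 2"
    using x uvw fin TS_nodesD(2)[OF I] by (simp add: card_Diff_subset)
  then have "card N = k" using k \<open>v \<noteq> w\<close> uvw fin by (simp add: N_def)
  moreover have "N \<subseteq> J \<union> K" by (auto simp: N_def J_eq K_eq)
  then have "N \<subseteq> pverts G" using TS_nodesD(1)[OF J'] TS_nodesD(1)[OF K'] by blast
  moreover have "(a, b) \<notin> parcs G" if "a \<in> N" "b \<in> N" for a b
  proof -
    \<comment> \<open>Any two elements of \<open>N\<close> other than the pair \<open>v\<close>,
      \<open>w\<close> lie together in \<open>J\<close> or in \<open>K\<close>, both
      independent.\<close>
    have "a \<in> J \<and> b \<in> J \<or> a \<in> K \<and> b \<in> K \<or> (a = v \<and> b = w) \<or> (a = w \<and> b = v)"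
      using that by (auto simp: N_def J_eq K_eq)
    then show ?thesis
      using TS_nodesD(3)[OF J'] TS_nodesD(3)[OF K'] \<open>(v, w) \<notin> parcs G\<close> sym by blast
  qed
  ultimately have N: "N \<in> TS_nodes k G" by (simp add: TS_nodes_def independent_set_def)
  have "N \<noteq> I" using uvw by (auto simp: N_def)
  moreover have "(I, N) \<notin> parcs (TS k G)"
  proof
    assume "(I, N) \<in> parcs (TS k G)"
    then obtain a where "I - N = {a}" by (auto simp: TS_arc_iff)
    moreover have "{u, x} \<subseteq> I - N" using uvw x by (auto simp: N_def)
    ultimately have "{u, x} \<subseteq> {a}" by simp
    then show False using x(2) by simp
  qed
  ultimately obtain Q where Q: "(I, Q) \<in> parcs (TS k G)" "(Q, N) \<in> parcs (TS k G)"
    using radius N by blast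
  obtain a b where ab: "I - Q = {a}" "Q - I = {b}" "(a, b) \<in> parcs G"
    using Q(1) by (auto simp: TS_arc_iff)
  obtain c d where cd: "Q - N = {c}" "N - Q = {d}" "(c, d) \<in> parcs G"
    using Q(2) by (auto simp: TS_arc_iff)
  have "v \<in> N" "w \<in> N" by (auto simp: N_def)
  \<comment> \<open>Only one element of \<open>N\<close> is missing from \<open>Q\<close>; so the
    token that \<open>Q\<close> gains over \<open>I\<close> is \<open>v\<close> or
    \<open>w\<close>.\<close>
  have "v \<in> Q \<or> w \<in> Q"
  proof (rule ccontr)
    assume "\<not> ?thesis"
    then have "{v, w} \<subseteq> {d}" using \<open>v \<in> N\<close> \<open>w \<in> N\<close> cd(2) by blast
    with \<open>v \<noteq> w\<close> show False by simp
  qed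
  then have "v \<in> Q - I \<or> w \<in> Q - I" using uvw by simp
  then have b: "b = v \<or> b = w" unfolding ab(2) by auto
  \<comment> \<open>Any other token of \<open>I\<close> survives in both \<open>J\<close> and
    \<open>K\<close>, hence is adjacent to neither \<open>v\<close> nor \<open>w\<close>.\<close>
  have "a = u"
  proof (rule ccontr)
    assume "a \<noteq> u"
    then have "a \<in> J" "a \<in> K" using ab(1) J_eq K_eq by auto
    moreover have "v \<in> J" "w \<in> K" using J_eq K_eq by simp_all
    ultimately show False
      using b ab(3) TS_nodesD(3)[OF J', of a v] TS_nodesD(3)[OF K', of a w] by auto
  qed
  with ab(1,2) have Q_eq: "Q = insert b (I - {u})" by blast
  have "x \<in> Q - N" using Q_eq x uvw by (auto simp: N_def)
  then have "c = x" unfolding cd(1) by simp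
  have "d \<in> N - Q" unfolding cd(2) by simp
  then have "d = v \<or> d = w" using Q_eq by (auto simp: N_def)
  moreover have "x \<in> J" "x \<in> K" "v \<in> J" "w \<in> K" using x J_eq K_eq by simp_all
  ultimately show False
    using cd(3) \<open>c = x\<close> TS_nodesD(3)[OF J', of x v] TS_nodesD(3)[OF K', of x w] by auto
qed

text \<open>By the previous lemma, \<open>J\<close> is determined by the singleton
  \<open>I - J\<close>, so the neighbours inject into the \<open>k\<close> tokens of
  \<open>I\<close>.\<close>

lemma TS_degree_le:
  assumes "pair_graph G" and k: "k \<ge> 2" and I: "I \<in> TS_nodes k G"
    and "\<And>J K. (I, J) \<in> parcs (TS k G) \<Longrightarrow> (I, K) \<in> parcs (TS k G) \<Longrightarrow>
      (J, K) \<notin> parcs (TS k G)"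
    and "\<And>N. N \<in> TS_nodes k G \<Longrightarrow> N \<noteq> I \<Longrightarrow> (I, N) \<notin> parcs (TS k G) \<Longrightarrow>
      \<exists>Q. (I, Q) \<in> parcs (TS k G) \<and> (Q, N) \<in> parcs (TS k G)"
  shows "card {J. (I, J) \<in> parcs (TS k G)} \<le> k"
proof -
  let ?A = "{J. (I, J) \<in> parcs (TS k G)}"
  have fin: "finite I" using k TS_nodesD(2)[OF I] by (intro card_ge_0_finite) simp
  have "inj_on (\<lambda>J. I - J) ?A"
    by (rule inj_onI, rule TS_moved_token_inj[OF assms(1,2)]) (use assms(4,5) in auto)
  moreover have "(\<lambda>J. I - J) ` ?A \<subseteq> (\<lambda>u. {u}) ` I"
  proof
    fix A assume "A \<in> (\<lambda>J. I - J) ` ?A"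
    then obtain J u where "A = I - J" "I - J = {u}" by (auto simp: TS_arc_iff)
    then show "A \<in> (\<lambda>u. {u}) ` I" by blast
  qed
  ultimately have "card ?A \<le> card ((\<lambda>u. {u}) ` I)" using fin by (intro card_inj_on_le) auto
  also have "\<dots> \<le> k" using card_image_le[OF fin] TS_nodesD(2)[OF I] by metis
  finally show ?thesis .
qed

section \<open>Necessity: applying the bound to \<open>P2\<close>\<close>

lemma D_graph_arc_iff:
  "(P2, y) \<in> parcs (D_graph r s) \<longleftrightarrow> y = P1 \<or> (\<exists>j<s. y = Leaf2 j)"
  "(P1, y) \<in> parcs (D_graph r s) \<longleftrightarrow> y = P2 \<or> (\<exists>i<r. y = Leaf1 i)"
  "(Leaf1 i, y) \<in> parcs (D_graph r s) \<longleftrightarrow> i < r \<and> y = P1"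
  "(Leaf2 j, y) \<in> parcs (D_graph r s) \<longleftrightarrow> j < s \<and> y = P2"
  by (auto simp: D_graph_def D_edges_def)

lemma D_graph_verts: "pverts (D_graph r s) = {P1, P2} \<union> Leaf1 ` {..<r} \<union> Leaf2 ` {..<s}"
  by (simp add: D_graph_def)

text \<open>\<open>P2\<close> has \<open>s + 1\<close> neighbours, namely \<open>P1\<close> and its
  own leaves, so the degree bound gives \<open>s + 1 \<le> k\<close>.\<close>

lemma TS_D_graph_imp_less:
  assumes "is_TS_graph k (D_graph r s)" and k: "k \<ge> 2"
  shows "s < k"
proof -
  let ?D = "D_graph r s"
  interpret D: pair_graph ?D by (rule pair_graph_D_graph)
  have wf: "pair_wf_digraph ?D" by unfold_locales
  obtain G :: "nat pair_pre_digraph" and f where G: "pair_graph G"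
    and f: "inj_on f (pverts ?D)" "pverts (TS k G) = f ` pverts ?D"
      "parcs (TS k G) = map_prod f f ` parcs ?D"
    using assms(1) unfolding is_TS_graph_def digraph_iso_with_proj_iff[OF wf] by blast
  have nodes: "TS_nodes k G = f ` pverts ?D" using f(2) by (simp add: TS_def)
  have arc: "(f x, f y) \<in> parcs (TS k G) \<longleftrightarrow> (x, y) \<in> parcs ?D"
    if "x \<in> pverts ?D" "y \<in> pverts ?D" for x y
  proof
    assume "(f x, f y) \<in> parcs (TS k G)"
    then obtain a b where "f a = f x" "f b = f y" "(a, b) \<in> parcs ?D"
      unfolding f(3) by auto
    with that show "(x, y) \<in> parcs ?D"
      using inj_onD[OF f(1)] D.in_arcsD1 D.in_arcsD2 by metis
  next
    assume "(x, y) \<in> parcs ?D"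
    then show "(f x, f y) \<in> parcs (TS k G)" unfolding f(3) by force
  qed
  have P2: "P2 \<in> pverts ?D" by (simp add: D_graph_verts)
  have nb: "\<exists>y. J = f y \<and> (P2, y) \<in> parcs ?D" if J: "(f P2, J) \<in> parcs (TS k G)" for J
  proof -
    from J have "J \<in> TS_nodes k G" by (simp add: TS_arc_iff)
    then obtain y where "y \<in> pverts ?D" "J = f y" using nodes by blast
    with J arc P2 show ?thesis by blast
  qed
  have nbs: "{J. (f P2, J) \<in> parcs (TS k G)} = f ` insert P1 (Leaf2 ` {..<s})" (is "?A = f ` ?B")
  proof
    show "?A \<subseteq> f ` ?B" using nb by (fastforce simp: D_graph_arc_iff)
    show "f ` ?B \<subseteq> ?A" using arc[OF P2] by (auto simp: D_graph_arc_iff D_graph_verts)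
  qed
  have "card {J. (f P2, J) \<in> parcs (TS k G)} \<le> k"
  proof (rule TS_degree_le[OF G k])
    show "f P2 \<in> TS_nodes k G" using nodes P2 by blast
  next
    fix J K assume "(f P2, J) \<in> parcs (TS k G)" "(f P2, K) \<in> parcs (TS k G)"
    then obtain y z where yz: "J = f y" "K = f z" "(P2, y) \<in> parcs ?D" "(P2, z) \<in> parcs ?D"
      using nb by blast
    then have "(y, z) \<notin> parcs ?D" by (auto simp: D_graph_arc_iff)
    with yz arc D.in_arcsD2 show "(J, K) \<notin> parcs (TS k G)" by blast
  next
    fix N assume N: "N \<in> TS_nodes k G" "N \<noteq> f P2" "(f P2, N) \<notin> parcs (TS k G)"
    then obtain y where y: "y \<in> pverts ?D" "N = f y" using nodes by blast
    with N arc P2 have "y \<noteq> P2" "(P2, y) \<notin> parcs ?D" by blast+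
    \<comment> \<open>Only the leaves at \<open>P1\<close> remain, and \<open>P1\<close> is the
      middle node.\<close>
    with y have "(P2, P1) \<in> parcs ?D" "(P1, y) \<in> parcs ?D"
      by (auto simp: D_graph_arc_iff D_graph_verts)
    with y show "\<exists>Q. (f P2, Q) \<in> parcs (TS k G) \<and> (Q, N) \<in> parcs (TS k G)"
      using arc D.in_arcsD1 D.in_arcsD2 by metis
  qed
  moreover have "inj_on f ?B"
    by (rule inj_on_subset[OF f(1)]) (auto simp: D_graph_verts)
  then have "card (f ` ?B) = Suc s"
    by (subst card_image) (auto simp: card_image inj_on_def card_insert_if)
  ultimately show ?thesis unfolding nbs by simp
qed

section \<open>Sufficiency: a graph realising \<open>D_graph r s\<close>\<close>

datatype vertex = U nat | V nat | W nat

text \<open>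
  \<open>W j\<close> is the target of the token on \<open>U (Suc j)\<close>, since \<open>U 0\<close> has no second target.
\<close>

fun adj :: "vertex \<Rightarrow> vertex \<Rightarrow> bool" where
  "adj (U i) (U j) \<longleftrightarrow> False"
| "adj (U i) (V j) \<longleftrightarrow> i = j"
| "adj (V j) (U i) \<longleftrightarrow> i = j"
| "adj (U i) (W j) \<longleftrightarrow> i = 0 \<or> i = Suc j"
| "adj (W j) (U i) \<longleftrightarrow> i = 0 \<or> i = Suc j"
| "adj (V i) (V j) \<longleftrightarrow> i \<noteq> j"
| "adj (V i) (W j) \<longleftrightarrow> i \<noteq> 0"
| "adj (W j) (V i) \<longleftrightarrow> i \<noteq> 0"
| "adj (W i) (W j) \<longleftrightarrow> i \<noteq> j"

lemma adj_sym: "adj x y \<longleftrightarrow> adj y x"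
  by (cases x; cases y) auto

lemma adj_irrefl: "\<not> adj x x"
  by (cases x) auto

definition token_graph :: "nat \<Rightarrow> nat \<Rightarrow> nat \<Rightarrow> vertex pair_pre_digraph" where
  "token_graph k r s =
    (let X = U ` {..<k} \<union> V ` {..s} \<union> W ` {..<r}
     in \<lparr> pverts = X, parcs = {(x, y). x \<in> X \<and> y \<in> X \<and> adj x y} \<rparr>)"

lemma token_graph_verts: "pverts (token_graph k r s) = U ` {..<k} \<union> V ` {..s} \<union> W ` {..<r}"
  by (simp add: token_graph_def Let_def)

lemma token_graph_arc_iff: "(x, y) \<in> parcs (token_graph k r s) \<longleftrightarrow>
    x \<in> pverts (token_graph k r s) \<and> y \<in> pverts (token_graph k r s) \<and> adj x y"
  by (simp add: token_graph_def Let_def)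

lemma pair_graph_token_graph: "pair_graph (token_graph k r s)"
proof -
  let ?G = "token_graph k r s"
  have "finite (pverts ?G)" by (simp add: token_graph_verts)
  moreover have "finite (parcs ?G)"
    by (rule finite_subset[of _ "pverts ?G \<times> pverts ?G"])
      (auto simp: token_graph_arc_iff token_graph_verts)
  moreover have "symmetric (with_proj ?G)"
    by (auto simp: symmetric_def token_graph_arc_iff adj_sym intro!: symI)
  ultimately show ?thesis
    by unfold_locales (auto simp: token_graph_arc_iff adj_irrefl)
qed

text \<open>The intended isomorphism. \<open>V 0\<close> is reserved for the move from
  \<open>P2\<close> to \<open>P1\<close>, hence the shift to \<open>Suc j\<close> at the leaves of
  \<open>P2\<close>.\<close>

primrec tokens :: "nat \<Rightarrow> D_vertex \<Rightarrow> vertex set" where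
  "tokens k P1 = insert (V 0) (U ` {..<k} - {U 0})"
| "tokens k P2 = U ` {..<k}"
| "tokens k (Leaf1 i) = insert (V 0) (insert (W i) (U ` {..<k} - {U 0, U (Suc i)}))"
| "tokens k (Leaf2 j) = insert (V (Suc j)) (U ` {..<k} - {U (Suc j)})"

text \<open>The indices of the \<open>V\<close> and \<open>W\<close> tokens already tell all nodes
  apart.\<close>

lemma inj_tokens: "inj (tokens k)"
proof (rule injI)
  fix x y assume "tokens k x = tokens k y"
  then have "{i. V i \<in> tokens k x} = {i. V i \<in> tokens k y}"
      "{i. W i \<in> tokens k x} = {i. W i \<in> tokens k y}"
    by simp_all
  then show "x = y" by (cases x; cases y) (auto simp: image_iff)
qed

lemma card_U_image: "card (U ` A) = card A"
  by (rule card_image) (simp add: inj_on_def)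

lemma tokens_in_TS_nodes:
  assumes "k \<ge> 2" "r \<le> s" "s < k" and x: "x \<in> pverts (D_graph r s)"
  shows "tokens k x \<in> TS_nodes k (token_graph k r s)"
proof -
  have "card (tokens k x) = k"
    using assms
    by (cases x) (auto simp: card_insert_if card_Diff_subset card_U_image D_graph_verts)
  moreover have "tokens k x \<subseteq> pverts (token_graph k r s)"
    using assms by (cases x) (auto simp: token_graph_verts D_graph_verts)
  moreover have "\<not> adj a b" if "a \<in> tokens k x" "b \<in> tokens k x" for a b
    using that by (cases x) auto
  ultimately show ?thesis
    by (auto simp: TS_nodes_def independent_set_def token_graph_arc_iff)
qed

lemma TS_nodes_token_graph:
  assumes "k \<ge> 2" "r \<le> s" "s < k"
  shows "TS_nodes k (token_graph k r s) = tokens k ` pverts (D_graph r s)"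
proof
  show "TS_nodes k (token_graph k r s) \<subseteq> tokens k ` pverts (D_graph r s)"
  proof
    fix X assume X: "X \<in> TS_nodes k (token_graph k r s)"
    let ?I = "U ` {..<k}"
    have card: "card X = k" and sub: "X \<subseteq> ?I \<union> V ` {..s} \<union> W ` {..<r}"
      using X by (auto simp: TS_nodes_def independent_set_def token_graph_verts)
    have ind: "\<not> adj a b" if "a \<in> X" "b \<in> X" for a b
      using that X by (auto simp: TS_nodes_def independent_set_def token_graph_arc_iff)
    have fin: "finite X" using sub by (rule finite_subset) simp
    \<comment> \<open>\<open>Y\<close> collects the \<open>V\<close> and \<open>W\<close> tokens of
      \<open>X\<close>, \<open>Z\<close> the \<open>U\<close> vertices they block. As
      \<open>X\<close> has \<open>k\<close> elements, counting forces every unblocked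
      \<open>U\<close> vertex into \<open>X\<close>.\<close>
    have fill: "X = Y \<union> (?I - Z)"
      if "Y \<subseteq> X" "X - Y \<subseteq> ?I - Z" "Z \<subseteq> ?I" "card Y \<le> card Z" for Y Z
    proof -
      have "finite Y" "finite Z" using that fin by (auto dest: finite_subset)
      then have "card (?I - Z) = k - card Z" "card (X - Y) = k - card Y"
        using that card by (simp_all add: card_Diff_subset card_U_image)
      then have "card (?I - Z) \<le> card (X - Y)" using that(4) by simp
      then have "X - Y = ?I - Z" using that(2) by (intro card_seteq) simp_all
      with that(1) show ?thesis by blast
    qed
    have U: "x \<in> ?I" if "x \<in> X" "\<And>i. x \<noteq> V i" "\<And>j. x \<noteq> W j" for x
      using sub that by auto
    consider (UU) "\<And>i. V i \<notin> X" "\<And>j. W j \<notin> X"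
      | (VV) i where "V i \<in> X" "\<And>j. W j \<notin> X"
      | (WW) j where "W j \<in> X" "\<And>i. V i \<notin> X"
      | (VW) i j where "V i \<in> X" "W j \<in> X" by metis
    then have "\<exists>x \<in> pverts (D_graph r s). X = tokens k x"
    proof cases
      case UU
      then have "X \<subseteq> ?I" using U by blast
      then have "X = {} \<union> (?I - {})" by (intro fill) auto
      then have "X = tokens k P2" by simp
      then show ?thesis by (auto simp: D_graph_verts)
    next
      case VV
      have i: "i \<le> s" using VV(1) sub by auto
      have "X - {V i} \<subseteq> ?I - {U i}"
      proof
        fix x assume x: "x \<in> X - {V i}"
        then have "x \<noteq> V i'" "x \<noteq> W j" "x \<noteq> U i" for i' j using ind[of "V i" x] VV by auto
        with x U show "x \<in> ?I - {U i}" by auto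
      qed
      then have "X = {V i} \<union> (?I - {U i})" using VV i assms(3) by (intro fill) auto
      \<comment> \<open>\<open>V 0\<close> gives \<open>P1\<close>, and \<open>V (Suc j)\<close>
        gives \<open>Leaf2 j\<close>.\<close>
      then have "X = tokens k (case i of 0 \<Rightarrow> P1 | Suc j \<Rightarrow> Leaf2 j)" by (cases i) auto
      then show ?thesis using i
        by (intro bexI[of _ "case i of 0 \<Rightarrow> P1 | Suc j \<Rightarrow> Leaf2 j"])
          (auto simp: D_graph_verts split: nat.split)
    next
      case WW
      have j: "j < r" using WW(1) sub by auto
      have "X - {W j} \<subseteq> ?I - {U 0, U (Suc j)}"
      proof
        fix x assume x: "x \<in> X - {W j}"
        then have "x \<noteq> V i" "x \<noteq> W j'" "x \<noteq> U 0" "x \<noteq> U (Suc j)" for i j'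
          using ind[of "W j" x] WW by auto
        with x U show "x \<in> ?I - {U 0, U (Suc j)}" by auto
      qed
      \<comment> \<open>A lone \<open>W j\<close> blocks two \<open>U\<close> vertices, leaving
        \<open>k - 2\<close> places for \<open>k - 1\<close> tokens.\<close>
      then have "card (X - {W j}) \<le> card (?I - {U 0, U (Suc j)})" by (intro card_mono) auto
      moreover have "card (X - {W j}) = k - 1" using WW card fin by simp
      moreover have "card (?I - {U 0, U (Suc j)}) = k - 2"
        using j assms by (subst card_Diff_subset) (auto simp: card_U_image)
      ultimately show ?thesis using assms(1) by simp
    next
      case VW
      have j: "j < r" using VW(2) sub by auto
      \<comment> \<open>\<open>V 0\<close> is the only \<open>V\<close> vertex not adjacent to the
        \<open>W\<close> vertices.\<close>
      have i: "i = 0" using ind[OF VW] by simp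
      have "X - {V 0, W j} \<subseteq> ?I - {U 0, U (Suc j)}"
      proof
        fix x assume x: "x \<in> X - {V 0, W j}"
        then have "x \<noteq> V i'" "x \<noteq> W j'" "x \<noteq> U 0" "x \<noteq> U (Suc j)" for i' j'
          using ind[of "V 0" x] ind[of "W j" x] VW i by auto
        with x U show "x \<in> ?I - {U 0, U (Suc j)}" by auto
      qed
      then have "X = {V 0, W j} \<union> (?I - {U 0, U (Suc j)})"
        using VW i j assms by (intro fill) auto
      then have "X = tokens k (Leaf1 j)" by simp
      then show ?thesis using j by (intro bexI[of _ "Leaf1 j"]) (auto simp: D_graph_verts)
    qed
    then show "X \<in> tokens k ` pverts (D_graph r s)" by blast
  qed
  show "tokens k ` pverts (D_graph r s) \<subseteq> TS_nodes k (token_graph k r s)"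
    using tokens_in_TS_nodes[OF assms] by blast
qed

lemma TS_token_graph_arc_iff:
  assumes "k \<ge> 2" "r \<le> s" "s < k"
    and x: "x \<in> pverts (D_graph r s)" and y: "y \<in> pverts (D_graph r s)"
  shows "(tokens k x, tokens k y) \<in> parcs (TS k (token_graph k r s)) \<longleftrightarrow>
    (x, y) \<in> parcs (D_graph r s)"
proof -
  let ?D = "D_graph r s" and ?T = "TS k (token_graph k r s)"
  interpret D: pair_graph ?D by (rule pair_graph_D_graph)
  interpret T: pair_graph ?T by (rule pair_graph_TS[OF pair_graph_token_graph])
  note nodes = tokens_in_TS_nodes[OF assms(1-3)]
  have slide: "(tokens k x, tokens k y) \<in> parcs ?T"
    if xy: "x \<in> pverts ?D" "y \<in> pverts ?D" and "a \<in> tokens k x" "b \<notin> tokens k x" "adj a b"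
      "tokens k y = insert b (tokens k x - {a})" for x y a b
  proof -
    have "a \<in> pverts (token_graph k r s)" "b \<in> pverts (token_graph k r s)"
      using TS_nodesD(1)[OF nodes[OF xy(1)]] TS_nodesD(1)[OF nodes[OF xy(2)]] that by auto
    then have "(a, b) \<in> parcs (token_graph k r s)" using that by (simp add: token_graph_arc_iff)
    moreover have "a \<noteq> b" using that by blast
    then have "tokens k x - tokens k y = {a}" "tokens k y - tokens k x = {b}" using that by auto
    ultimately show ?thesis using nodes xy by (simp add: TS_arc_iff)
  qed
  \<comment> \<open>Two tokens leaving at once exclude a slide, in either direction by
    symmetry.\<close>
  have no_slide: "(tokens k x, tokens k y) \<notin> parcs ?T" "(tokens k y, tokens k x) \<notin> parcs ?T"
    if "a \<in> tokens k x" "b \<in> tokens k x" "a \<notin> tokens k y" "b \<notin> tokens k y" "a \<noteq> b" for x y a b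
  proof -
    have "tokens k x - tokens k y \<noteq> {c}" for c
    proof
      assume "tokens k x - tokens k y = {c}"
      moreover have "{a, b} \<subseteq> tokens k x - tokens k y" using that by blast
      ultimately have "{a, b} \<subseteq> {c}" by simp
      with that show False by simp
    qed
    then show "(tokens k x, tokens k y) \<notin> parcs ?T" by (auto simp: TS_arc_iff)
    then show "(tokens k y, tokens k x) \<notin> parcs ?T" using T.arcs_symmetric by blast
  qed
  have irrefl: "(tokens k x, tokens k x) \<notin> parcs ?T" for x using T.no_loops' by blast
  have "(tokens k P1, tokens k (Leaf2 j)) \<notin> parcs ?T \<and>
      (tokens k (Leaf2 j), tokens k P1) \<notin> parcs ?T" for j
    using no_slide[of "V (Suc j)" "Leaf2 j" "U 0" P1] assms(1) by auto
  moreover have "(tokens k P2, tokens k (Leaf1 i)) \<notin> parcs ?T \<and>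
      (tokens k (Leaf1 i), tokens k P2) \<notin> parcs ?T" for i
    using no_slide[of "V 0" "Leaf1 i" "W i" P2] by auto
  moreover have "(tokens k (Leaf1 i), tokens k (Leaf2 j)) \<notin> parcs ?T \<and>
      (tokens k (Leaf2 j), tokens k (Leaf1 i)) \<notin> parcs ?T" for i j
    using no_slide[of "V 0" "Leaf1 i" "W i" "Leaf2 j"] by auto
  \<comment> \<open>For distinct leaves of one kind, the second departing token is
    \<open>U (Suc j)\<close>, vacated only in the target; \<open>j < r\<close> ensures that this
    vertex exists.\<close>
  moreover have "(tokens k (Leaf1 i), tokens k (Leaf1 j)) \<notin> parcs ?T" if "j < r" for i j
    using no_slide(1)[of "W i" "Leaf1 i" "U (Suc j)" "Leaf1 j"] irrefl[of "Leaf1 i"] that assms(2,3)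
    by (cases "i = j") auto
  moreover have "(tokens k (Leaf2 i), tokens k (Leaf2 j)) \<notin> parcs ?T" if "j < s" for i j
    using no_slide(1)[of "V (Suc i)" "Leaf2 i" "U (Suc j)" "Leaf2 j"] irrefl[of "Leaf2 i"] that assms(3)
    by (cases "i = j") auto
  ultimately have "(x, y) \<in> parcs ?D" if "(tokens k x, tokens k y) \<in> parcs ?T"
    using that x y irrefl
    by (cases x; cases y) (auto simp: D_graph_arc_iff D_graph_verts simp del: tokens.simps)
  moreover have "(tokens k x, tokens k y) \<in> parcs ?T"
    if "(x, y) \<in> D_edges r s \<union> (D_edges r s)\<inverse>"
  proof -
    have "(tokens k a, tokens k b) \<in> parcs ?T" if "(a, b) \<in> D_edges r s" for a b
    proof -
      from that consider "a = P1" "b = P2" | i where "i < r" "a = P1" "b = Leaf1 i"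
        | j where "j < s" "a = P2" "b = Leaf2 j"
        by (auto simp: D_edges_def)
      then show ?thesis
      proof cases
        case 1
        then show ?thesis using assms(1)
          by (intro slide[of _ _ "V 0" "U 0"]) (auto simp: D_graph_verts)
      next
        case 2
        then show ?thesis using assms(2,3)
          by (intro slide[of _ _ "U (Suc i)" "W i"]) (auto simp: D_graph_verts)
      next
        case 3
        then show ?thesis using assms(3)
          by (intro slide[of _ _ "U (Suc j)" "V (Suc j)"]) (auto simp: D_graph_verts)
      qed
    qed
    with that show ?thesis using T.arcs_symmetric by blast
  qed
  ultimately show ?thesis by (auto simp: D_graph_def)
qed

theorem proposition30:
  fixes k r s :: nat
  assumes "k \<ge> 2" and "1 \<le> r" and "r \<le> s"
  shows "is_TS_graph k (D_graph r s) \<longleftrightarrow> s \<le> k - 1"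
proof
  assume "is_TS_graph k (D_graph r s)"
  with assms(1) show "s \<le> k - 1" using TS_D_graph_imp_less by fastforce
next
  assume "s \<le> k - 1"
  with assms(1) have s: "s < k" by simp
  let ?D = "D_graph r s" and ?G = "token_graph k r s"
  interpret D: pair_graph ?D by (rule pair_graph_D_graph)
  have wf: "pair_wf_digraph ?D" by unfold_locales
  note nodes = TS_nodes_token_graph[OF assms(1,3) s]
  note arc = TS_token_graph_arc_iff[OF assms(1,3) s]
  have "parcs (TS k ?G) = map_prod (tokens k) (tokens k) ` parcs ?D" (is "?L = ?R")
  proof
    show "?L \<subseteq> ?R"
    proof
      fix e assume e: "e \<in> ?L"
      then obtain A B where "e = (A, B)" "A \<in> TS_nodes k ?G" "B \<in> TS_nodes k ?G"
        by (cases e) (auto simp: TS_arc_iff)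
      then obtain x y where "e = (tokens k x, tokens k y)" "x \<in> pverts ?D" "y \<in> pverts ?D"
        unfolding nodes by blast
      with e arc show "e \<in> ?R" by force
    qed
    show "?R \<subseteq> ?L"
    proof
      fix e assume "e \<in> ?R"
      then obtain x y where "e = (tokens k x, tokens k y)" "(x, y) \<in> parcs ?D" by auto
      then show "e \<in> ?L" using arc D.in_arcsD1 D.in_arcsD2 by blast
    qed
  qed
  moreover have "pverts (TS k ?G) = tokens k ` pverts ?D" using nodes by (simp add: TS_def)
  moreover have "inj_on (tokens k) (pverts ?D)" using inj_tokens by (rule inj_on_subset) simp
  ultimately have "digraph_iso (with_proj ?D) (with_proj (TS k ?G))"
    unfolding digraph_iso_with_proj_iff[OF wf] by blast
  \<comment> \<open>\<open>is_TS_graphI\<close> passes from the type \<open>vertex\<close> to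
    natural numbers.\<close>
  with pair_graph_token_graph wf show "is_TS_graph k ?D" by (rule is_TS_graphI)
qed

end
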